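(* Let $b$ be an interpolating Blaschke product with zero set $\{z_n:n\in\mathbb N\}$. Suppose that for some $\sigma\in\,]0,1[$ the set $$G:=\bigcup_{n} D_\rho(z_n,\sigma)$$ is connected. Then $b$ is a one-component inner function. This holds in particular if, for some constant $\sigma<1$, $\rho(z_n,z_{n+1})<\sigma<1$ for all $n$; for example if $z_n=1-2^{-n}$.
   Context: $\mathbb D$ is the open unit disk. $\rho(z,w)=\left|\frac{z-w}{1-\overline z w}\right|$ is the pseudohyperbolic distance on $\mathbb D$, and $D_\rho(z_0,r)=\{z\in\mathbb D:\rho(z,z_0)<r\}$ for $0<r<1$. A Blaschke product $b$ with zero sequence $\{z_n:n\in\mathbb N\}$ is an interpolating Blaschke product if $\inf_n (1-|z_n|^2)|b'(z_n)|>0$. An inner function $u$ is a one-component inner function if there is $\eta\in\,]0,1[$ such that the level set $\Omega_u(\eta)=\{z\in\mathbb D:|u(z)|<\eta\}$ is connected. *)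

theory Defs
  imports "HOL-Complex_Analysis.Complex_Analysis"
begin

abbreviation unit_disk :: "complex set" where
  "unit_disk \<equiv> ball 0 1"

definition rho :: "complex \<Rightarrow> complex \<Rightarrow> real" where
  "rho z w = cmod ((z - w) / (1 - cnj z * w))"

definition rho_disk :: "complex \<Rightarrow> real \<Rightarrow> complex set" where
  "rho_disk z0 r = {z \<in> unit_disk. rho z z0 < r}"

text \<open>The radial-limit condition is \<open>2 * pi\<close>-periodic in \<open>t\<close>, so \<open>lborel\<close>-almost every
  \<open>t\<close> means almost every point \<open>cis t\<close> of the unit circle.\<close>

definition inner_function :: "(complex \<Rightarrow> complex) \<Rightarrow> bool" where
  "inner_function u \<longleftrightarrow>
     u holomorphic_on unit_disk \<and> bounded (u ` unit_disk) \<and>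
     (AE t in lborel. \<exists>w. cmod w = 1 \<and>
        ((\<lambda>r. u (complex_of_real r * cis t)) \<longlongrightarrow> w) (at_left 1))"

definition level_set :: "(complex \<Rightarrow> complex) \<Rightarrow> real \<Rightarrow> complex set" where
  "level_set u \<eta> = {z \<in> unit_disk. cmod (u z) < \<eta>}"

definition one_component_inner :: "(complex \<Rightarrow> complex) \<Rightarrow> bool" where
  "one_component_inner u \<longleftrightarrow>
     inner_function u \<and> (\<exists>\<eta>. 0 < \<eta> \<and> \<eta> < 1 \<and> connected (level_set u \<eta>))"

text \<open>The unimodular normalisation makes the factor positive at \<open>0\<close>, which ensures that
  the infinite product converges; the factor for \<open>a = 0\<close> is \<open>z\<close>.\<close>

definition blaschke_factor :: "complex \<Rightarrow> complex \<Rightarrow> complex" where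
  "blaschke_factor a z =
     (if a = 0 then z else (complex_of_real (cmod a) / a) * ((a - z) / (1 - cnj a * z)))"

definition blaschke_sequence :: "(nat \<Rightarrow> complex) \<Rightarrow> bool" where
  "blaschke_sequence z \<longleftrightarrow>
     (\<forall>n. z n \<in> unit_disk) \<and> summable (\<lambda>n. 1 - cmod (z n))"

text \<open>The sequence \<open>z\<close> lists the zeros of \<open>b\<close> with multiplicity. The values of \<open>b\<close> outside
  the unit disk are irrelevant.\<close>

definition blaschke_product :: "(complex \<Rightarrow> complex) \<Rightarrow> (nat \<Rightarrow> complex) \<Rightarrow> bool" where
  "blaschke_product b z \<longleftrightarrow>
     blaschke_sequence z \<and>
     (\<exists>c. cmod c = 1 \<and> (\<forall>w\<in>unit_disk. b w = c * (\<Prod>n. blaschke_factor (z n) w)))"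

definition interpolating_blaschke_product ::
    "(complex \<Rightarrow> complex) \<Rightarrow> (nat \<Rightarrow> complex) \<Rightarrow> bool" where
  "interpolating_blaschke_product b z \<longleftrightarrow>
     blaschke_product b z \<and> (INF n. (1 - (cmod (z n))\<^sup>2) * cmod (deriv b (z n))) > 0"

end

theory Submission imports Defs begin

text \<open>
Let \<open>G\<close> be the connected union of the disks \<open>rho_disk (z n) \<sigma>\<close>. Two facts about the Blaschke product
\<open>b\<close> have to be established.

\<^item> The level set of \<open>b\<close> at height \<open>\<sigma>\<close> is connected. It contains \<open>G\<close>, since \<open>cmod (b w) \<le> rho w (z n)\<close>.
  Every component of a level set of a Blaschke product contains a zero
  (\<open>component_of_level_set_contains_zero\<close>): on a zero-free component one applies the maximum modulus
  principle to \<open>\<sigma>\<close> divided by a finite partial product, which is continuous up to the unit circle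
  and has modulus \<open>1\<close> there. So every component meets, and therefore contains, the connected set \<open>G\<close>.

\<^item> \<open>b\<close> has radial limits of modulus \<open>1\<close> almost everywhere. At a boundary point that is not an
  accumulation point of the zeros this is clear, because the product converges uniformly on the
  closed radius. Connectedness of \<open>G\<close> forces the accumulation points to be a null set
  (\<open>AE_cis_away_from_zeros\<close>), which replaces an appeal to Fatou's theorem. By the Blaschke condition
  and the Borel-Cantelli lemma almost every radius meets only finitely many of the disks. Suppose
  that the radius at \<open>t\<close> is of this kind, yet zeros accumulate at \<open>cis t\<close>. To reach these zeros without
  crossing the radius, \<open>G\<close> has to sweep over a full one-sided neighbourhood of directions at \<open>t\<close>. Then
  \<open>t\<close> is an endpoint of an interval of swept directions, and there are only countably many such
  endpoints.

If consecutive zeros have distance less than \<open>\<sigma>\<close>, then consecutive disks overlap and \<open>G\<close> is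
connected. For the zeros \<open>1 - 2 ^ (- n)\<close> the number \<open>(1 - (cmod (z n))\<^sup>2) * cmod (deriv b (z n))\<close> is
the product of the distances from \<open>z n\<close> to the other zeros, and the distance of two zeros whose
indices differ by \<open>j\<close> is at least \<open>(1 - 2 ^ (- j)) / (1 + 2 ^ (- j))\<close>; the product of these numbers
over all \<open>j \<ge> 1\<close> is positive.
\<close>

section \<open>Blaschke factors and the convergence of Blaschke products\<close>

lemma one_minus_cnj_mult_nonzero:
  assumes "cmod a < 1" "cmod w \<le> 1"
  shows "1 - cnj a * w \<noteq> 0"
proof
  assume "1 - cnj a * w = 0"
  hence "cmod (cnj a * w) = 1" by (metis eq_iff_diff_eq_0 norm_one)
  moreover have "cmod a * cmod w \<le> cmod a" using assms by (simp add: mult_left_le)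
  ultimately show False using assms by (simp add: norm_mult)
qed

lemma norm_blaschke_factor: "cmod (blaschke_factor a w) = rho w a"
proof -
  have "cmod (1 - cnj a * w) = cmod (1 - cnj w * a)"
    by (metis complex_cnj_cnj complex_cnj_diff complex_cnj_mult complex_cnj_one
        complex_mod_cnj mult.commute)
  thus ?thesis
    by (simp add: blaschke_factor_def rho_def norm_mult norm_divide norm_minus_commute)
qed

lemma rho_commute: "rho z w = rho w z"
proof -
  have "cmod (1 - cnj z * w) = cmod (1 - cnj w * z)"
    by (metis complex_cnj_cnj complex_cnj_diff complex_cnj_mult complex_cnj_one
        complex_mod_cnj mult.commute)
  thus ?thesis by (simp add: rho_def norm_divide norm_minus_commute)
qed

lemma rho_nonneg: "0 \<le> rho z w"
  by (simp add: rho_def)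

text \<open>This identity carries all comparisons of \<open>rho w a\<close> with \<open>1\<close>: its right-hand side is nonnegative
when both points lie in the closed disk and vanishes when \<open>w\<close> is on the unit circle.\<close>

lemma norm_one_minus_cnj_mult_identity:
  "(cmod (1 - cnj w * a))\<^sup>2 - (cmod (w - a))\<^sup>2 = (1 - (cmod w)\<^sup>2) * (1 - (cmod a)\<^sup>2)"
  unfolding cmod_power2 by (simp add: power2_eq_square algebra_simps)

lemma rho_le_1:
  assumes "cmod a < 1" "cmod w \<le> 1"
  shows "rho w a \<le> 1"
proof -
  have "0 \<le> (1 - (cmod w)\<^sup>2) * (1 - (cmod a)\<^sup>2)"
    using assms by (simp add: power_le_one)
  hence "(cmod (w - a))\<^sup>2 \<le> (cmod (1 - cnj w * a))\<^sup>2"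
    using norm_one_minus_cnj_mult_identity[of w a] by linarith
  hence "cmod (w - a) \<le> cmod (1 - cnj w * a)" by (rule power2_le_imp_le) simp
  thus ?thesis by (auto simp: rho_def norm_divide divide_le_eq_1)
qed

lemma rho_eq_1:
  assumes "cmod a < 1" "cmod w = 1"
  shows "rho w a = 1"
proof -
  have "(cmod (w - a))\<^sup>2 = (cmod (1 - cnj w * a))\<^sup>2"
    using norm_one_minus_cnj_mult_identity[of w a] assms by simp
  hence "cmod (w - a) = cmod (1 - cnj w * a)" by simp
  moreover have "cmod (w - a) \<noteq> 0" using assms by auto
  ultimately show ?thesis unfolding rho_def norm_divide by (metis div_self)
qed

lemma continuous_on_blaschke_factor:
  assumes "cmod a < 1"
  shows "continuous_on (cball 0 1) (blaschke_factor a)"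
  unfolding blaschke_factor_def using one_minus_cnj_mult_nonzero[OF assms]
  by (cases "a = 0") (auto intro!: continuous_intros)

lemma holomorphic_on_blaschke_factor:
  assumes "cmod a < 1"
  shows "blaschke_factor a holomorphic_on ball 0 1"
  unfolding blaschke_factor_def using one_minus_cnj_mult_nonzero[OF assms]
  by (cases "a = 0") (auto intro!: holomorphic_intros simp: less_imp_le)

text \<open>For \<open>a \<noteq> 0\<close> the normalised factor differs from \<open>1\<close> by exactly
\<open>- (1 - cmod a) * (a + cmod a * w) / (a * (1 - cnj a * w))\<close>, so the Blaschke condition makes the
product converge absolutely wherever \<open>1 - cnj a * w\<close> stays away from \<open>0\<close> along the zeros.\<close>

lemma norm_blaschke_factor_minus_1_le:
  assumes "cmod a < 1" "cmod w \<le> 1"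
  shows "cmod (blaschke_factor a w - 1) \<le> 2 * (1 - cmod a) / cmod (1 - cnj a * w)"
proof (cases "a = 0")
  case True
  have "cmod (w - 1) \<le> cmod w + 1" using norm_triangle_ineq4[of w 1] by simp
  thus ?thesis using True assms by (simp add: blaschke_factor_def)
next
  case False
  let ?q = "1 - cnj a * w" and ?m = "complex_of_real (cmod a)"
  have q: "?q \<noteq> 0" using one_minus_cnj_mult_nonzero[OF assms] .
  have r: "cmod (1 - ?m) = 1 - cmod a"
  proof -
    have "1 - ?m = complex_of_real (1 - cmod a)" by simp
    thus ?thesis using assms unfolding \<open>1 - ?m = _\<close> norm_of_real by linarith
  qed
  have aa: "a * cnj a = ?m * ?m"
    by (simp add: complex_norm_square[symmetric] power2_eq_square[symmetric])
  have "(blaschke_factor a w - 1) * (a * ?q) = ?m * (a - w) - a * ?q"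
    using False q by (simp add: blaschke_factor_def field_simps)
  also have "\<dots> = ?m * (a - w) - a + (a * cnj a) * w" by (simp add: algebra_simps)
  also have "\<dots> = - ((1 - ?m) * (a + ?m * w))" unfolding aa by (simp add: algebra_simps)
  finally have "cmod ((blaschke_factor a w - 1) * (a * ?q)) = cmod ((1 - ?m) * (a + ?m * w))"
    by simp
  hence "cmod (blaschke_factor a w - 1) * cmod a * cmod ?q = (1 - cmod a) * cmod (a + ?m * w)"
    unfolding norm_mult by (simp add: r mult.assoc)
  also have "\<dots> \<le> (1 - cmod a) * (2 * cmod a)"
  proof (rule mult_left_mono)
    have "cmod (a + ?m * w) \<le> cmod a + cmod a * cmod w"
      using norm_triangle_ineq[of a "?m * w"] by (simp add: norm_mult)
    also have "\<dots> \<le> 2 * cmod a" using assms by (simp add: mult_left_le)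
    finally show "cmod (a + ?m * w) \<le> 2 * cmod a" .
  qed (use assms in simp)
  finally have "cmod a * (cmod (blaschke_factor a w - 1) * cmod ?q) \<le> cmod a * (2 * (1 - cmod a))"
    by (simp only: mult.assoc mult.commute mult.left_commute)
  hence "cmod (blaschke_factor a w - 1) * cmod ?q \<le> 2 * (1 - cmod a)"
    using False by simp
  thus ?thesis using q by (simp add: pos_le_divide_eq)
qed

lemma convergent_prod_blaschke:
  assumes z: "blaschke_sequence z" and w: "cmod w \<le> 1" and d: "0 < d"
    and away: "\<And>n. d \<le> cmod (1 - cnj (z n) * w)"
  shows "convergent_prod (\<lambda>n. blaschke_factor (z n) w)"
proof -
  have z1: "cmod (z n) < 1" for n using z by (auto simp: blaschke_sequence_def)
  have "summable (\<lambda>n. norm (blaschke_factor (z n) w - 1))"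
  proof (rule summable_comparison_test')
    show "summable (\<lambda>n. 2 / d * (1 - cmod (z n)))"
      using z by (intro summable_mult) (auto simp: blaschke_sequence_def)
    fix n :: nat
    have "cmod (blaschke_factor (z n) w - 1) \<le> 2 * (1 - cmod (z n)) / cmod (1 - cnj (z n) * w)"
      using norm_blaschke_factor_minus_1_le[OF z1 w] .
    also have "\<dots> \<le> 2 * (1 - cmod (z n)) / d"
      using away[of n] z1[of n] d by (intro divide_left_mono mult_pos_pos) auto
    finally show "norm (norm (blaschke_factor (z n) w - 1)) \<le> 2 / d * (1 - cmod (z n))" by simp
  qed
  hence "abs_convergent_prod (\<lambda>n. blaschke_factor (z n) w)"
    by (simp add: abs_convergent_prod_conv_summable)
  thus ?thesis by (rule abs_convergent_prod_imp_convergent_prod)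
qed

text \<open>The set \<open>S\<close> may reach the unit circle. Besides compact subsets of the open disk, the lemma is
meant for a closed radius whose endpoint is not an accumulation point of the zeros.\<close>

lemma uniform_limit_blaschke:
  assumes z: "blaschke_sequence z" and S: "compact S" "S \<subseteq> cball 0 1" and d: "0 < d"
    and away: "\<And>n w. w \<in> S \<Longrightarrow> d \<le> cmod (1 - cnj (z n) * w)"
  shows "uniform_limit S (\<lambda>N w. \<Prod>n<N. blaschke_factor (z n) w)
           (\<lambda>w. \<Prod>n. blaschke_factor (z n) w) sequentially"
proof -
  have z1: "cmod (z n) < 1" for n using z by (auto simp: blaschke_sequence_def)
  have "uniformly_convergent_on S (\<lambda>N w. \<Prod>n<N. blaschke_factor (z n) w)"
  proof (rule uniformly_convergent_on_prod'[OF _ S(1)])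
    show "continuous_on S (blaschke_factor (z n))" for n
      using continuous_on_subset[OF continuous_on_blaschke_factor[OF z1] S(2)] .
    show "uniformly_convergent_on S (\<lambda>N w. \<Sum>n<N. norm (blaschke_factor (z n) w - 1))"
    proof (rule Weierstrass_m_test'_ev[OF always_eventually, THEN _])
      show "summable (\<lambda>n. 2 / d * (1 - cmod (z n)))"
        using z by (intro summable_mult) (auto simp: blaschke_sequence_def)
      show "\<forall>n. \<forall>w\<in>S. norm (norm (blaschke_factor (z n) w - 1)) \<le> 2 / d * (1 - cmod (z n))"
      proof (intro allI ballI)
        fix n w assume w: "w \<in> S"
        hence w1: "cmod w \<le> 1" using S by auto
        have "cmod (blaschke_factor (z n) w - 1)
                \<le> 2 * (1 - cmod (z n)) / cmod (1 - cnj (z n) * w)"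
          using norm_blaschke_factor_minus_1_le[OF z1 w1] .
        also have "\<dots> \<le> 2 * (1 - cmod (z n)) / d"
          using away[OF w, of n] z1[of n] d by (intro divide_left_mono mult_pos_pos) auto
        finally show "norm (norm (blaschke_factor (z n) w - 1)) \<le> 2 / d * (1 - cmod (z n))"
          by simp
      qed
    qed
  qed
  then obtain l where l: "uniform_limit S (\<lambda>N w. \<Prod>n<N. blaschke_factor (z n) w) l sequentially"
    by (auto simp: uniformly_convergent_on_def)
  have "l w = (\<Prod>n. blaschke_factor (z n) w)" if w: "w \<in> S" for w
  proof -
    have "(\<lambda>N. \<Prod>n<N. blaschke_factor (z n) w) \<longlonglongrightarrow> l w"
      using tendsto_uniform_limitI[OF l w] .
    moreover have "convergent_prod (\<lambda>n. blaschke_factor (z n) w)"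
      using convergent_prod_blaschke[OF z _ d] away w S by auto
    hence "(\<lambda>N. \<Prod>n<N. blaschke_factor (z n) w) \<longlonglongrightarrow> (\<Prod>n. blaschke_factor (z n) w)"
      using convergent_prod_LIMSEQ LIMSEQ_lessThan_iff_atMost by blast
    ultimately show ?thesis by (rule LIMSEQ_unique)
  qed
  thus ?thesis using l uniform_limit_cong'[of S _ _ l] by (metis (no_types, lifting))
qed

lemma norm_one_minus_cnj_mult_ge:
  assumes "cmod a < 1" "cmod w \<le> r"
  shows "1 - r \<le> cmod (1 - cnj a * w)"
proof -
  have "cmod a * cmod w \<le> 1 * r" using assms by (intro mult_mono) auto
  moreover have "1 - cmod (cnj a * w) \<le> cmod (1 - cnj a * w)"
    using norm_triangle_ineq2[of 1 "cnj a * w"] by simp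
  ultimately show ?thesis by (simp add: norm_mult)
qed

lemma LIMSEQ_blaschke:
  assumes z: "blaschke_sequence z" and w: "w \<in> ball 0 1"
  shows "(\<lambda>N. \<Prod>n<N. blaschke_factor (z n) w) \<longlonglongrightarrow> (\<Prod>n. blaschke_factor (z n) w)"
proof -
  have z1: "cmod (z n) < 1" for n using z by (auto simp: blaschke_sequence_def)
  have d: "0 < 1 - cmod w" using w by simp
  have "convergent_prod (\<lambda>n. blaschke_factor (z n) w)"
    using norm_one_minus_cnj_mult_ge[OF z1 order_refl, of w] w
    by (intro convergent_prod_blaschke[OF z _ d]) auto
  thus ?thesis using convergent_prod_LIMSEQ LIMSEQ_lessThan_iff_atMost by blast
qed

lemma holomorphic_blaschke_prodinf:
  assumes z: "blaschke_sequence z"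
  shows "(\<lambda>w. \<Prod>n. blaschke_factor (z n) w) holomorphic_on ball 0 1"
proof (rule holomorphic_uniform_sequence[OF open_ball])
  have z1: "cmod (z n) < 1" for n using z by (auto simp: blaschke_sequence_def)
  show "(\<lambda>w. \<Prod>n<N. blaschke_factor (z n) w) holomorphic_on ball 0 1" for N
    by (intro holomorphic_intros holomorphic_on_blaschke_factor z1)
  fix x :: complex assume x: "x \<in> ball 0 1"
  define d where "d = (1 - cmod x) / 2"
  have d: "d > 0" using x by (simp add: d_def)
  have sub: "cmod w \<le> 1 - d" if "w \<in> cball x d" for w
    using that norm_triangle_ineq2[of w x] by (simp add: dist_norm norm_minus_commute d_def field_simps)
  have "uniform_limit (cball x d) (\<lambda>N w. \<Prod>n<N. blaschke_factor (z n) w)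
           (\<lambda>w. \<Prod>n. blaschke_factor (z n) w) sequentially"
  proof (rule uniform_limit_blaschke[OF z _ _ d])
    show "cball x d \<subseteq> cball 0 1" using sub d by force
    show "d \<le> cmod (1 - cnj (z n) * w)" if "w \<in> cball x d" for n w
      using norm_one_minus_cnj_mult_ge[OF z1[of n] sub[OF that]] by simp
  qed auto
  moreover have "cball x d \<subseteq> ball 0 1" using sub d by force
  ultimately show "\<exists>d>0. cball x d \<subseteq> ball 0 1 \<and> uniform_limit (cball x d)
      (\<lambda>N w. \<Prod>n<N. blaschke_factor (z n) w) (\<lambda>w. \<Prod>n. blaschke_factor (z n) w) sequentially"
    using d by blast
qed

text \<open>The partial products decrease in modulus, every factor being at most \<open>1\<close> there.\<close>

lemma blaschke_prodinf_le_partial: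
  assumes z: "blaschke_sequence z" and w: "w \<in> ball 0 1"
  shows "cmod (\<Prod>n. blaschke_factor (z n) w) \<le> cmod (\<Prod>n<N. blaschke_factor (z n) w)"
proof (rule LIMSEQ_le_const2[OF tendsto_norm[OF LIMSEQ_blaschke[OF z w]]])
  have le: "cmod (blaschke_factor (z n) w) \<le> 1" for n
    using z w by (auto simp: norm_blaschke_factor blaschke_sequence_def intro!: rho_le_1)
  have "decseq (\<lambda>N. cmod (\<Prod>n<N. blaschke_factor (z n) w))"
    using le by (intro decseq_SucI) (auto simp: norm_mult mult_left_le)
  thus "\<exists>M. \<forall>k\<ge>M. cmod (\<Prod>n<k. blaschke_factor (z n) w) \<le> cmod (\<Prod>n<N. blaschke_factor (z n) w)"
    by (auto simp: decseq_def)
qed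

lemma blaschke_prodinf_le_factor:
  assumes z: "blaschke_sequence z" and w: "w \<in> ball 0 1"
  shows "cmod (\<Prod>n. blaschke_factor (z n) w) \<le> rho w (z m)"
proof -
  have le: "cmod (blaschke_factor (z n) w) \<le> 1" for n
    using z w by (auto simp: norm_blaschke_factor blaschke_sequence_def intro!: rho_le_1)
  have "cmod (\<Prod>n. blaschke_factor (z n) w) \<le> cmod (\<Prod>n<Suc m. blaschke_factor (z n) w)"
    using blaschke_prodinf_le_partial[OF z w] .
  also have "\<dots> = (\<Prod>n<m. cmod (blaschke_factor (z n) w)) * rho w (z m)"
    by (simp add: norm_mult norm_blaschke_factor flip: prod_norm)
  also have "\<dots> \<le> 1 * rho w (z m)"
    using le by (intro mult_right_mono prod_le_1 rho_nonneg) auto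
  finally show ?thesis by simp
qed

section \<open>Connected level sets\<close>

text \<open>On a component \<open>W\<close> without zeros every finite partial product \<open>P N\<close> satisfies
\<open>\<eta> \<le> cmod (P N w)\<close>. By the maximum modulus principle for \<open>\<eta> / P N\<close> this needs to be checked only
on the frontier of \<open>W\<close>: at frontier points inside the disk \<open>P N\<close> dominates the full product, whose
modulus is at least \<open>\<eta>\<close> there, and on the unit circle \<open>P N\<close> is continuous of modulus \<open>1\<close>. The limit
in \<open>N\<close> contradicts that \<open>W\<close> lies in the level set. Working with the partial products rather than
with their limit is what makes the boundary behaviour harmless.\<close>

lemma component_of_level_set_contains_zero:
  assumes z: "blaschke_sequence z" and \<eta>: "0 < \<eta>" "\<eta> < 1"
    and W: "W \<in> components (level_set (\<lambda>w. \<Prod>n. blaschke_factor (z n) w) \<eta>)"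
  shows "\<exists>n. z n \<in> W"
proof (rule ccontr)
  assume "\<not> ?thesis"
  hence noz: "z n \<notin> W" for n by blast
  define B where "B = (\<lambda>w. \<Prod>n. blaschke_factor (z n) w)"
  define P where "P = (\<lambda>N w. \<Prod>n<N. blaschke_factor (z n) w)"
  note W = W[folded B_def]
  have z1: "cmod (z n) < 1" for n using z by (auto simp: blaschke_sequence_def)
  have holB: "B holomorphic_on ball 0 1" unfolding B_def by (rule holomorphic_blaschke_prodinf[OF z])
  have contB: "continuous_on (ball 0 1) (\<lambda>w. cmod (B w))"
    using holB by (intro continuous_intros holomorphic_on_imp_continuous_on)
  have Bint: "level_set B \<eta> = (\<lambda>w. cmod (B w)) -` {..<\<eta>} \<inter> ball 0 1"
    by (auto simp: level_set_def)
  have opL: "open (level_set B \<eta>)"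
    using continuous_open_preimage[OF contB open_ball, of "{..<\<eta>}"]
    by (simp add: Bint Int_commute)
  have opW: "open W" using open_components[OF opL W] .
  have Wsub: "W \<subseteq> level_set B \<eta>" using in_components_subset[OF W] .
  have WD: "W \<subseteq> ball 0 1" using Wsub by (auto simp: level_set_def)
  have clD: "closure W \<subseteq> cball 0 1" using WD by (metis closure_ball closure_mono zero_less_one)
  have BP: "cmod (B w) \<le> cmod (P N w)" if "w \<in> ball 0 1" for w N
    unfolding B_def P_def using blaschke_prodinf_le_partial[OF z that] .
  \<comment> \<open>A frontier point inside the disk lies outside the level set, since the component is maximal.\<close>
  have frB: "\<eta> \<le> cmod (B w)" if "w \<in> frontier W" "w \<in> ball 0 1" for w
  proof (rule ccontr)
    assume "\<not> ?thesis"
    hence "w \<in> level_set B \<eta>" using that by (auto simp: level_set_def)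
    moreover have "frontier W \<inter> level_set B \<eta> = {}"
    proof -
      have "frontier W \<subseteq> frontier (level_set B \<eta>)" using frontier_of_components_subset[OF W] .
      thus ?thesis using opL by (auto simp: frontier_def interior_open)
    qed
    ultimately show False using that by blast
  qed
  have P1: "cmod (P N w) = 1" if "cmod w = 1" for N w
    using that z1 by (auto simp: P_def prod_norm[symmetric] norm_blaschke_factor rho_eq_1)
  have frP: "\<eta> \<le> cmod (P N w)" if "w \<in> frontier W" for w N
  proof (cases "w \<in> ball 0 1")
    case True
    thus ?thesis using frB[OF that True] BP[OF True, of N] by linarith
  next
    case False
    hence "cmod w = 1" using that clD by (auto simp: frontier_def)
    thus ?thesis using P1 \<eta> by simp
  qed
  have Pnz: "P N w \<noteq> 0" if "w \<in> closure W" for N w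
  proof (cases "w \<in> W")
    case True
    have "blaschke_factor (z n) w \<noteq> 0" for n
    proof -
      have "rho w (z n) \<noteq> 0"
        using True noz[of n] one_minus_cnj_mult_nonzero[of w "z n"] WD z1[of n]
        by (auto simp: rho_def)
      thus ?thesis by (metis norm_blaschke_factor norm_zero)
    qed
    thus ?thesis by (simp add: P_def)
  next
    case False
    hence "w \<in> frontier W" using that opW by (simp add: frontier_def interior_open)
    thus ?thesis using frP[of w N] \<eta> by auto
  qed
  have PW: "\<eta> \<le> cmod (P N w)" if w: "w \<in> W" for N w
  proof -
    have "cmod (\<eta> / P N w) \<le> 1"
    proof (rule maximum_modulus_frontier[where S = W and f = "\<lambda>w. \<eta> / P N w"])
      have "P N holomorphic_on ball 0 1"
        unfolding P_def by (intro holomorphic_intros holomorphic_on_blaschke_factor z1)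
      hence "P N holomorphic_on W" using WD by (rule holomorphic_on_subset)
      thus "(\<lambda>w. \<eta> / P N w) holomorphic_on interior W"
        using opW Pnz closure_subset[of W] by (auto simp: interior_open intro!: holomorphic_intros)
      have "continuous_on (closure W) (P N)"
        unfolding P_def
        by (intro continuous_intros continuous_on_subset[OF continuous_on_blaschke_factor clD] z1)
      thus "continuous_on (closure W) (\<lambda>w. \<eta> / P N w)"
        using Pnz by (auto intro!: continuous_intros)
      show "bounded W" using WD bounded_subset bounded_ball by blast
      show "cmod (\<eta> / P N w) \<le> 1" if "w \<in> frontier W" for w
        using frP[OF that, of N] \<eta> by (simp add: norm_divide divide_le_eq_1)
    qed (rule w)
    moreover have "P N w \<noteq> 0" using Pnz w closure_subset by blast
    ultimately show ?thesis using \<eta> by (simp add: norm_divide divide_le_eq_1)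
  qed
  obtain w where w: "w \<in> W" using in_components_nonempty[OF W] by blast
  have "(\<lambda>N. cmod (P N w)) \<longlonglongrightarrow> cmod (B w)"
    unfolding P_def B_def using w WD by (intro tendsto_norm LIMSEQ_blaschke[OF z]) auto
  hence "\<eta> \<le> cmod (B w)" using PW[OF w] by (intro LIMSEQ_le_const) auto
  thus False using w Wsub by (auto simp: level_set_def)
qed

text \<open>The union of the disks lies in the level set and contains all zeros. Being connected it lies in
every component, as every component contains a zero; so there is only one.\<close>

lemma connected_level_set_if_connected_disks:
  assumes z: "blaschke_sequence z" and \<sigma>: "0 < \<sigma>" "\<sigma> < 1"
    and G: "connected (\<Union>n. rho_disk (z n) \<sigma>)"
  shows "connected (level_set (\<lambda>w. \<Prod>n. blaschke_factor (z n) w) \<sigma>)"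
proof -
  let ?L = "level_set (\<lambda>w. \<Prod>n. blaschke_factor (z n) w) \<sigma>" and ?G = "\<Union>n. rho_disk (z n) \<sigma>"
  have "?G \<subseteq> ?L"
    using blaschke_prodinf_le_factor[OF z]
    by (fastforce simp: level_set_def rho_disk_def intro: le_less_trans)
  moreover have zG: "z n \<in> ?G" for n
    using z \<sigma> by (auto simp: rho_disk_def rho_def blaschke_sequence_def intro!: exI[of _ n])
  ultimately have "?G \<subseteq> W" if "W \<in> components ?L" for W
    using component_of_level_set_contains_zero[OF z \<sigma> that] components_maximal[OF that G] by blast
  hence "W = W'" if "W \<in> components ?L" "W' \<in> components ?L" for W W'
    using that zG[of 0] components_eq[OF that] by blast
  thus ?thesis by (simp add: connected_eq_connected_components_eq)
qed

section \<open>Exceptional directions form a null set\<close>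

lemma dist_cis: "cmod (cis s - cis t) = 2 * \<bar>sin ((s - t) / 2)\<bar>"
proof -
  have "cis s - cis t = cis t * (cis (s - t) - 1)"
    by (simp add: cis_mult right_diff_distrib)
  thus ?thesis by (simp add: norm_mult cis_conv_exp dist_exp_i_1 del: of_real_diff)
qed

lemma dist_cis_le: "cmod (cis s - cis t) \<le> \<bar>s - t\<bar>"
  unfolding dist_cis using abs_sin_x_le_abs_x[of "(s - t) / 2"] by simp

text \<open>A lower bound for chords in terms of arcs: it turns closeness on the circle into closeness of the
parameters, which is what measuring sets of directions requires.\<close>

lemma dist_cis_ge:
  assumes "\<bar>s - t\<bar> \<le> 1"
  shows "\<bar>s - t\<bar> \<le> 2 * cmod (cis s - cis t)"
proof -
  have *: "y \<le> 2 * sin y" if "0 \<le> y" "y \<le> 1 / 2" for y :: real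
  proof -
    have "1 / 2 \<le> cos u" if "0 \<le> u" "u \<le> 1 / 2" for u :: real
    proof -
      have "cos (pi / 3) \<le> cos u" using that pi_ge_two by (intro cos_monotone_0_pi_le) auto
      thus ?thesis by (simp add: cos_60)
    qed
    moreover have "((\<lambda>u. 2 * sin u - u) has_real_derivative 2 * cos u - 1) (at u)" for u :: real
      by (auto intro!: derivative_eq_intros)
    ultimately have "(\<lambda>u. 2 * sin u - u) 0 \<le> (\<lambda>u. 2 * sin u - u) y"
      by (intro DERIV_nonneg_imp_nondecreasing[OF that(1)] exI[of _ "2 * cos _ - 1"] conjI)
        (use that in force)+
    thus ?thesis by simp
  qed
  have "\<bar>s - t\<bar> / 2 \<le> 2 * sin (\<bar>s - t\<bar> / 2)" using assms by (intro *) auto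
  also have "\<bar>s - t\<bar> / 2 = \<bar>(s - t) / 2\<bar>" by simp
  also have "2 * sin \<bar>(s - t) / 2\<bar> \<le> 2 * \<bar>sin ((s - t) / 2)\<bar>"
    unfolding abs_if[of "(s - t) / 2"] sin_minus by auto
  finally show ?thesis unfolding dist_cis by simp
qed

text \<open>The parameters in an interval of length \<open>1\<close> at which \<open>cis\<close> hits the \<open>n\<close>-th ball lie in an interval
of length \<open>8 * e n\<close>; so the Borel-Cantelli lemma applies on each \<open>[c, c + 1]\<close>, \<open>c\<close> an integer.\<close>

lemma AE_cis_in_finitely_many_balls:
  assumes sum: "summable e" and nn: "\<And>n. 0 \<le> e n"
  shows "AE t in lborel. finite {n. cmod (cis t - a n) \<le> e n}"
proof -
  define A where "A = (\<lambda>(c::int) n. {t \<in> {of_int c..of_int c + 1}. cmod (cis t - a n) \<le> e n})"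
  have clA: "closed (A c n)" for c n
  proof -
    have "A c n = {of_int c..of_int c + 1} \<inter> {t. cmod (cis t - a n) \<le> e n}" by (auto simp: A_def)
    moreover have "closed {t. cmod (cis t - a n) \<le> e n}"
      by (intro closed_Collect_le continuous_intros)
    ultimately show ?thesis by (simp add: closed_Int)
  qed
  have emA: "emeasure lborel (A c n) \<le> ennreal (8 * e n)" for c n
  proof (cases "A c n = {}")
    case False
    then obtain s where s: "s \<in> A c n" by blast
    have "A c n \<subseteq> {s - 4 * e n..s + 4 * e n}"
    proof
      fix t assume t: "t \<in> A c n"
      have "cmod (cis t - cis s) \<le> cmod (cis t - a n) + cmod (cis s - a n)"
        using norm_triangle_ineq4[of "cis t - a n" "cis s - a n"] by simp
      hence "cmod (cis t - cis s) \<le> 2 * e n" using s t by (auto simp: A_def)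
      moreover have "\<bar>t - s\<bar> \<le> 2 * cmod (cis t - cis s)"
        using s t by (intro dist_cis_ge) (auto simp: A_def)
      ultimately have "\<bar>t - s\<bar> \<le> 4 * e n" by linarith
      thus "t \<in> {s - 4 * e n..s + 4 * e n}" by auto
    qed
    hence "emeasure lborel (A c n) \<le> emeasure lborel {s - 4 * e n..s + 4 * e n}"
      by (intro emeasure_mono) auto
    also have "\<dots> = ennreal (8 * e n)" using nn[of n] by simp
    finally show ?thesis .
  qed auto
  have "AE t in lborel. eventually (\<lambda>n. t \<in> space lborel - A c n) sequentially" for c
  proof (rule borel_cantelli_AE1)
    show "A c n \<in> sets lborel" for n using borel_closed[OF clA] by simp
    show "emeasure lborel (A c n) < \<infinity>" for n
      using emA[of c n] by (metis ennreal_less_top infinity_ennreal_def le_less_trans)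
    have "measure lborel (A c n) \<le> 8 * e n" for n
      unfolding measure_def using emA[of c n] nn[of n] by (intro enn2real_leI) auto
    thus "summable (\<lambda>n. measure lborel (A c n))"
      by (intro summable_comparison_test'[OF summable_mult[OF sum, of 8], of 0]) simp
  qed
  hence "AE t in lborel. \<forall>c. eventually (\<lambda>n. t \<in> space lborel - A c n) sequentially"
    by (simp add: AE_all_countable)
  thus ?thesis
  proof eventually_elim
    case (elim t)
    hence "eventually (\<lambda>n. t \<notin> A \<lfloor>t\<rfloor> n) sequentially" by (auto elim: eventually_mono)
    then obtain N where "\<And>n. n \<ge> N \<Longrightarrow> t \<notin> A \<lfloor>t\<rfloor> n" by (auto simp: eventually_sequentially)
    moreover have "t \<in> A \<lfloor>t\<rfloor> n" if "cmod (cis t - a n) \<le> e n" for n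
      using that of_int_floor_le[of t] floor_correct[of t] unfolding A_def by simp
    ultimately have "n < N" if "cmod (cis t - a n) \<le> e n" for n
      using that by (meson not_le)
    hence "{n. cmod (cis t - a n) \<le> e n} \<subseteq> {..<N}" by blast
    thus ?case using finite_subset by blast
  qed
qed

text \<open>Such a \<open>t\<close> is the left endpoint of a gap-free stretch of \<open>U\<close>. A rational number in that stretch
determines \<open>t\<close>, because of two such points the larger one would lie in the stretch of the smaller.\<close>

lemma countable_left_endpoints:
  fixes U :: "real set"
  shows "countable {t. t \<notin> U \<and> (\<exists>d>0. {t<..<t + d} \<subseteq> U)}" (is "countable ?L")
proof -
  have "\<exists>q::rat. t < of_rat q \<and> {t<..of_rat q} \<subseteq> U" if "t \<in> ?L" for t
  proof -
    obtain d where d: "d > 0" "{t<..<t + d} \<subseteq> U" using \<open>t \<in> ?L\<close> by blast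
    obtain q where "t < of_rat q" "of_rat q < t + d" using of_rat_dense[of t "t + d"] d by auto
    thus ?thesis using d by (intro exI[of _ q]) auto
  qed
  hence "\<forall>t\<in>?L. \<exists>q::rat. t < of_rat q \<and> {t<..of_rat q} \<subseteq> U" by blast
  from bchoice[OF this] obtain q :: "real \<Rightarrow> rat"
    where q: "\<And>t. t \<in> ?L \<Longrightarrow> t < of_rat (q t) \<and> {t<..of_rat (q t)} \<subseteq> U" by blast
  have "inj_on q ?L"
  proof (rule inj_onI)
    fix s t assume st: "s \<in> ?L" "t \<in> ?L" "q s = q t"
    have "s \<in> {t<..of_rat (q t)}" if "t < s" using that q[OF st(1)] st(3) by simp
    moreover have "t \<in> {s<..of_rat (q s)}" if "s < t" using that q[OF st(2)] st(3) by simp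
    moreover have "s \<notin> U" "t \<notin> U" using st by auto
    ultimately have "\<not> t < s" "\<not> s < t" using q[OF st(1)] q[OF st(2)] by blast+
    thus "s = t" by simp
  qed
  thus ?thesis by (rule countableI')
qed

lemma countable_right_endpoints:
  fixes U :: "real set"
  shows "countable {t. t \<notin> U \<and> (\<exists>d>0. {t - d<..<t} \<subseteq> U)}"
proof -
  let ?V = "uminus ` U"
  have "{t. t \<notin> U \<and> (\<exists>d>0. {t - d<..<t} \<subseteq> U)}
      \<subseteq> uminus ` {t. t \<notin> ?V \<and> (\<exists>d>0. {t<..<t + d} \<subseteq> ?V)}"
  proof
    fix t assume "t \<in> {t. t \<notin> U \<and> (\<exists>d>0. {t - d<..<t} \<subseteq> U)}"
    then obtain d where d: "t \<notin> U" "d > 0" "{t - d<..<t} \<subseteq> U" by blast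
    have "x \<in> ?V" if "x \<in> {- t<..<- t + d}" for x
      using that d by (intro image_eqI[of _ _ "- x"]) auto
    hence "- t \<in> {t. t \<notin> ?V \<and> (\<exists>d>0. {t<..<t + d} \<subseteq> ?V)}" using d by auto
    thus "t \<in> uminus ` {t. t \<notin> ?V \<and> (\<exists>d>0. {t<..<t + d} \<subseteq> ?V)}"
      by (intro image_eqI[of _ _ "- t"]) auto
  qed
  thus ?thesis by (rule countable_subset[OF _ countable_image[OF countable_left_endpoints]])
qed

text \<open>A pseudohyperbolic disk around \<open>a\<close> of fixed radius has Euclidean size comparable to the distance of
\<open>a\<close> to the unit circle. As \<open>rho\<close> is symmetric, \<open>a\<close> and \<open>w\<close> may be exchanged in the bound.\<close>

lemma dist_le_if_rho_less:
  assumes a: "cmod a < 1" and w: "cmod w < 1" and rho: "rho w a < \<sigma>" and \<sigma>: "\<sigma> < 1"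
  shows "cmod (w - a) \<le> 2 / (1 - \<sigma>) * (1 - cmod a)"
proof -
  have s0: "0 < \<sigma>" using rho rho_nonneg[of w a] by linarith
  have "1 - cnj w * a \<noteq> 0" using one_minus_cnj_mult_nonzero[of w a] a w by simp
  hence "cmod (w - a) \<le> \<sigma> * cmod (1 - cnj w * a)"
    using rho by (simp add: rho_def norm_divide pos_divide_less_eq)
  also have "cmod (1 - cnj w * a) \<le> 2 * (1 - cmod a) + cmod (w - a)"
  proof -
    have "1 - cnj w * a = (1 - cnj a * a) - cnj (w - a) * a" by (simp add: algebra_simps)
    hence "cmod (1 - cnj w * a) \<le> cmod (1 - cnj a * a) + cmod (cnj (w - a) * a)"
      using norm_triangle_ineq4 by metis
    also have "1 - cnj a * a = of_real (1 - (cmod a)\<^sup>2)"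
      by (simp add: complex_norm_square[symmetric] mult.commute)
    also have "cmod (of_real (1 - (cmod a)\<^sup>2)) = (1 - cmod a) * (1 + cmod a)"
      using a unfolding norm_of_real by (simp add: abs_square_le_1 power2_eq_square algebra_simps mult_le_one)
    also have "\<dots> \<le> (1 - cmod a) * 2" using a by (intro mult_left_mono) auto
    also have "cmod (cnj (w - a) * a) \<le> cmod (w - a)"
      using a by (simp add: norm_mult mult_left_le del: complex_cnj_diff)
    finally show ?thesis by simp
  qed
  finally have "cmod (w - a) \<le> \<sigma> * (2 * (1 - cmod a) + cmod (w - a))" using s0 by simp
  hence "(1 - \<sigma>) * cmod (w - a) \<le> \<sigma> * (2 * (1 - cmod a))" by (simp add: algebra_simps)
  also have "\<dots> \<le> 1 * (2 * (1 - cmod a))" using \<sigma> a by (intro mult_right_mono) auto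
  finally show ?thesis using \<sigma> by (simp add: field_simps)
qed

text \<open>A disk \<open>rho_disk (z n) \<sigma>\<close> that meets the ball of radius \<open>(1 - r) / 2\<close> around \<open>r * cis t\<close> has size and
depth comparable to \<open>1 - r\<close>, hence its centre satisfies the inequality in the finiteness assumption.
So only finitely many disks are in question, and these stay away from the unit circle.\<close>

lemma cone_avoids_disks:
  fixes \<sigma> :: real and z :: "nat \<Rightarrow> complex"
  defines "C \<equiv> 2 / (1 - \<sigma>)"
  assumes z: "\<And>n. cmod (z n) < 1" and \<sigma>: "\<sigma> < 1"
    and fin: "finite {n. cmod (cis t - z n) \<le> (4 * C + 3) * (1 - cmod (z n))}"
  shows "\<exists>r0<1. \<forall>r. r0 \<le> r \<and> r < 1 \<longrightarrow>
           ball (of_real r * cis t) ((1 - r) / 2) \<inter> (\<Union>n. rho_disk (z n) \<sigma>) = {}"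
proof -
  let ?F = "{n. cmod (cis t - z n) \<le> (4 * C + 3) * (1 - cmod (z n))}"
  define m where "m = Min (insert 1 ((\<lambda>n. 1 - cmod (z n)) ` ?F))"
  have C: "C > 0" using \<sigma> by (simp add: C_def)
  have m: "m > 0" unfolding m_def using fin z by (subst Min_gr_iff) auto
  have mF: "m \<le> 1 - cmod (z n)" if "n \<in> ?F" for n
    unfolding m_def using fin that by (intro Min_le) auto
  \<comment> \<open>For \<open>r \<ge> r0\<close> a disk with centre at depth \<open>m\<close> or more lies too deep to meet the ball.\<close>
  define r0 where "r0 = max 0 (1 - m / (2 * (1 + C)))"
  have "r0 < 1" using m C by (simp add: r0_def)
  moreover have "ball (of_real r * cis t) ((1 - r) / 2) \<inter> (\<Union>n. rho_disk (z n) \<sigma>) = {}"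
    if r: "r0 \<le> r" "r < 1" for r
  proof (rule ccontr)
    assume "\<not> ?thesis"
    then obtain w n where w: "dist (of_real r * cis t) w < (1 - r) / 2" "cmod w < 1" "rho w (z n) < \<sigma>"
      by (auto simp: rho_disk_def)
    have r00: "0 \<le> r" using r by (simp add: r0_def)
    have rt: "cmod (of_real r * cis t) = r" using r00 by (simp add: norm_mult)
    have wr: "\<bar>cmod w - r\<bar> \<le> (1 - r) / 2"
      using w(1) norm_triangle_ineq3[of w "of_real r * cis t"] rt by (simp add: dist_norm norm_minus_commute)
    have d1: "cmod (w - z n) \<le> C * (1 - cmod (z n))"
      unfolding C_def using dist_le_if_rho_less[OF z w(2) w(3) \<sigma>] .
    have "rho (z n) w < \<sigma>" using w(3) by (simp add: rho_commute)
    hence d2: "cmod (w - z n) \<le> C * (1 - cmod w)"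
      unfolding C_def using dist_le_if_rho_less[OF w(2) z _ \<sigma>, of n] by (simp add: norm_minus_commute)
    have e1: "1 - r \<le> 2 * ((1 + C) * (1 - cmod (z n)))"
    proof -
      have "1 - r \<le> 2 * (1 - cmod w)" using wr abs_ge_self[of "cmod w - r"] by argo
      moreover have "1 - cmod w \<le> (1 - cmod (z n)) + cmod (w - z n)"
        using norm_triangle_ineq3[of w "z n"] by linarith
      ultimately show ?thesis using d1 unfolding distrib_right mult_1 by argo
    qed
    \<comment> \<open>Passing from \<open>cis t\<close> to \<open>z n\<close> via \<open>r * cis t\<close> and \<open>w\<close> costs \<open>3 * (1 + C)\<close> and \<open>C\<close> times the depth of \<open>z n\<close>.\<close>
    have "cmod (cis t - of_real r * cis t) = 1 - r"
    proof -
      have "cis t - of_real r * cis t = of_real (1 - r) * cis t" by (simp add: algebra_simps)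
      thus ?thesis using r by (simp add: norm_mult del: of_real_diff)
    qed
    moreover have "cmod (cis t - z n) \<le> cmod (cis t - of_real r * cis t)
        + cmod (of_real r * cis t - w) + cmod (w - z n)"
      using norm_triangle_ineq[of "cis t - of_real r * cis t" "of_real r * cis t - w"]
        norm_triangle_ineq[of "cis t - w" "w - z n"] by simp
    ultimately have "cmod (cis t - z n) \<le> (1 - r) + (1 - r) / 2 + cmod (w - z n)"
      using w(1) unfolding dist_norm by argo
    also have "\<dots> \<le> 3 * ((1 + C) * (1 - cmod (z n))) + C * (1 - cmod (z n))"
      using e1 d1 by argo
    also have "\<dots> = (4 * C + 3) * (1 - cmod (z n))" by (simp add: algebra_simps)
    finally have nF: "n \<in> ?F" by simp
    have "1 - cmod (z n) \<le> (1 + C) * (1 - cmod w)"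
      using d2 norm_triangle_ineq3[of w "z n"] unfolding distrib_right mult_1 by linarith
    also have "\<dots> \<le> (1 + C) * (3 / 2 * (1 - r))"
    proof (rule mult_left_mono)
      show "1 - cmod w \<le> 3 / 2 * (1 - r)" using wr abs_ge_minus_self[of "cmod w - r"] by argo
    qed (use C in simp)
    also have "\<dots> \<le> (1 + C) * (3 / 2 * (m / (2 * (1 + C))))"
      using r C by (intro mult_left_mono) (auto simp: r0_def)
    also have "\<dots> = 3 / 4 * m" using C by (simp add: field_simps)
    also have "\<dots> < m" using m by simp
    finally show False using mF[OF nF] by simp
  qed
  ultimately show ?thesis by blast
qed

text \<open>The two rays at \<open>s1\<close> and \<open>s2\<close>, from radius \<open>r\<close> outwards, and the circular arc of radius \<open>r\<close> between
them bound a sector that is a neighbourhood of \<open>cis t\<close> in the disk. None of these three pieces meets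
\<open>G\<close>: the rays by assumption, and the arc because it is contained in the ball around \<open>r * cis t\<close>. A
connected \<open>G\<close> with a point \<open>x\<close> outside the sector therefore avoids the sector.\<close>

lemma connected_avoiding_rays_stays_away:
  fixes G :: "complex set"
  assumes G: "connected G" "G \<subseteq> ball 0 1" and r: "0 < r" "r < 1"
    and x: "x \<in> G" "cmod x \<le> r"
    and avoid: "ball (of_real r * cis t) ((1 - r) / 2) \<inter> G = {}"
    and s1: "t < s1" "s1 < t + (1 - r) / 2" "\<And>\<rho>. r < \<rho> \<Longrightarrow> \<rho> < 1 \<Longrightarrow> of_real \<rho> * cis s1 \<notin> G"
    and s2: "t - (1 - r) / 2 < s2" "s2 < t" "\<And>\<rho>. r < \<rho> \<Longrightarrow> \<rho> < 1 \<Longrightarrow> of_real \<rho> * cis s2 \<notin> G"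
  shows "\<exists>d>0. ball (cis t) d \<inter> G = {}"
proof -
  \<comment> \<open>\<open>S\<close> is the open sector, written with half-planes so that openness is evident, and \<open>S'\<close> the
      interior of its complement.\<close>
  define S where "S = {w. r < cmod w \<and> Im (w * cis (- s1)) < 0 \<and> 0 < Im (w * cis (- s2))
                        \<and> 0 < Re (w * cis (- t))}"
  define S' where "S' = {w. cmod w < r \<or> 0 < Im (w * cis (- s1)) \<or> Im (w * cis (- s2)) < 0
                        \<or> Re (w * cis (- t)) < 0}"
  have opS: "open S" "open S'"
    unfolding S_def S'_def
    by (intro open_Collect_conj open_Collect_disj open_Collect_less continuous_intros)+
  have "S \<inter> S' = {}" by (auto simp: S_def S'_def)
  have cover: "G \<subseteq> S \<union> S'"
  proof (rule subsetI, rule ccontr)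
    fix w assume w: "w \<in> G" "w \<notin> S \<union> S'"
    \<comment> \<open>The angle of \<open>w\<close> measured from the direction \<open>t\<close>.\<close>
    define \<phi> where "\<phi> = Arg (w * cis (- t))"
    have w1: "r \<le> cmod w" "cmod w < 1" using w G(2) by (auto simp: S'_def)
    have "w * cis (- t) = of_real (cmod w) * cis \<phi>"
      using rcis_cmod_Arg[of "w * cis (- t)"] by (simp add: \<phi>_def rcis_def norm_mult)
    hence "w * cis (- t) * cis t = of_real (cmod w) * cis \<phi> * cis t" by simp
    hence weq: "w = of_real (cmod w) * cis (t + \<phi>)" by (simp add: mult.assoc cis_mult add.commute)
    have rot: "w * cis (- u) = of_real (cmod w) * cis (t + \<phi> - u)" for u
      by (subst weq) (simp add: mult.assoc cis_mult)
    have range: "- pi < \<phi>" "\<phi> \<le> pi" using Arg_bounded[of "w * cis (- t)"] by (auto simp: \<phi>_def)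
    have pos: "cmod w > 0" using w1 r by linarith
    have cos: "0 \<le> cos \<phi>" and sin1: "sin (\<phi> - (s1 - t)) \<le> 0" and sin2: "0 \<le> sin (\<phi> + (t - s2))"
    proof -
      have "0 \<le> cmod w * cos \<phi>" "cmod w * sin (\<phi> - (s1 - t)) \<le> 0"
        "0 \<le> cmod w * sin (\<phi> + (t - s2))"
        using w(2) unfolding S'_def Un_iff mem_Collect_eq rot by (auto simp: not_less algebra_simps)
      thus "0 \<le> cos \<phi>" "sin (\<phi> - (s1 - t)) \<le> 0" "0 \<le> sin (\<phi> + (t - s2))"
        using pos by (simp_all add: zero_le_mult_iff mult_le_0_iff)
    qed
    have half: "- (pi / 2) \<le> \<phi>" "\<phi> \<le> pi / 2"
    proof -
      show "\<phi> \<le> pi / 2"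
      proof (rule ccontr)
        assume "\<not> ?thesis"
        hence "0 < sin (\<phi> - pi / 2)" using range pi_gt_zero by (intro sin_gt_zero) linarith+
        thus False using cos by (simp add: sin_diff)
      qed
      show "- (pi / 2) \<le> \<phi>"
      proof (rule ccontr)
        assume "\<not> ?thesis"
        hence "0 < sin (- \<phi> - pi / 2)" using range pi_gt_zero by (intro sin_gt_zero) linarith+
        thus False using cos by (simp add: sin_diff)
      qed
    qed
    have small: "s1 - t < 1 / 2" "t - s2 < 1 / 2" using s1(2) s2(1) r by (simp_all add: field_simps)
    have up: "\<phi> \<le> s1 - t"
    proof (rule ccontr)
      assume "\<not> ?thesis"
      hence "0 < sin (\<phi> - (s1 - t))" using half s1 pi_gt_zero by (intro sin_gt_zero) linarith+
      thus False using sin1 by simp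
    qed
    have lo: "- (t - s2) \<le> \<phi>"
    proof (rule ccontr)
      assume "\<not> ?thesis"
      hence "0 < sin (- (\<phi> + (t - s2)))" using half s2 pi_gt_zero by (intro sin_gt_zero) linarith+
      thus False using sin2 by (simp only: sin_minus)
    qed
    have ne_r: "cmod w \<noteq> r"
    proof
      assume eq: "cmod w = r"
      have "w - of_real r * cis t = of_real r * (cis (t + \<phi>) - cis t)"
        by (subst weq) (simp add: eq right_diff_distrib)
      hence "cmod (w - of_real r * cis t) = r * cmod (cis (t + \<phi>) - cis t)"
        using r by (simp add: norm_mult)
      also have "\<dots> \<le> 1 * \<bar>\<phi>\<bar>"
        using r dist_cis_le[of "t + \<phi>" t] by (intro mult_mono) auto
      also have "\<dots> < (1 - r) / 2" using up lo s1 s2 by linarith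
      finally have "w \<in> ball (of_real r * cis t) ((1 - r) / 2)"
        by (simp add: dist_norm norm_minus_commute)
      thus False using avoid w by blast
    qed
    hence w2: "r < cmod w" using w1 by simp
    have "\<phi> \<noteq> s1 - t"
    proof
      assume "\<phi> = s1 - t"
      hence "w = of_real (cmod w) * cis s1" using weq by simp
      thus False using s1(3)[OF w2 w1(2)] w by simp
    qed
    hence "0 < sin (s1 - t - \<phi>)" using up half small pi_ge_two by (intro sin_gt_zero) linarith+
    hence b1: "Im (w * cis (- s1)) < 0"
      using pos sin_minus[of "s1 - t - \<phi>"] by (simp add: rot mult_less_0_iff algebra_simps)
    have "\<phi> \<noteq> - (t - s2)"
    proof
      assume "\<phi> = - (t - s2)"
      hence "w = of_real (cmod w) * cis s2" using weq by simp
      thus False using s2(3)[OF w2 w1(2)] w by simp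
    qed
    hence "0 < sin (t + \<phi> - s2)" using lo half small pi_ge_two by (intro sin_gt_zero) linarith+
    hence b2: "0 < Im (w * cis (- s2))" using pos by (simp add: rot)
    have "0 < cos \<phi>" using up lo small pi_ge_two by (intro cos_gt_zero_pi) linarith+
    hence b3: "0 < Re (w * cis (- t))" using pos by (simp add: rot)
    show False using w(2) w2 b1 b2 b3 by (simp add: S_def)
  qed
  have "x \<notin> S" using x by (simp add: S_def)
  hence "x \<in> S' \<inter> G" using x cover by blast
  hence "S \<inter> G = {}" using connectedD[OF G(1) opS] cover \<open>S \<inter> S' = {}\<close> by blast
  moreover have "cis t \<in> S"
  proof -
    have "s1 - t < pi" "t - s2 < pi" using s1(2) s2(1) r pi_ge_two by argo+
    hence "0 < sin (s1 - t)" "0 < sin (t - s2)" using s1(1) s2(2) by (simp_all add: sin_gt_zero)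
    moreover have "sin (t - s1) = - sin (s1 - t)" using sin_minus[of "s1 - t"] by simp
    ultimately show ?thesis using r unfolding S_def mem_Collect_eq cis_mult by simp
  qed
  then obtain d where "d > 0" "ball (cis t) d \<subseteq> S" using opS(1) openE by blast
  ultimately show ?thesis by blast
qed

text \<open>Accumulation points of the zeros on the circle form a null set. Almost every direction \<open>t\<close> satisfies
the hypothesis of \<open>cone_avoids_disks\<close>. If moreover \<open>cis t\<close> is an accumulation point, then
some hypothesis of \<open>connected_avoiding_rays_stays_away\<close> must fail for all nearby \<open>s1\<close> and \<open>s2\<close>, so on one side of
\<open>t\<close> all nearby rays, but not the ray at \<open>t\<close> itself, meet the union of the disks beyond a certain
radius \<open>R j\<close>. Only countably many \<open>t\<close> are endpoints in this sense.\<close>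

lemma AE_cis_away_from_zeros:
  assumes z: "blaschke_sequence z" and \<sigma>: "0 < \<sigma>" "\<sigma> < 1"
    and G: "connected (\<Union>n. rho_disk (z n) \<sigma>)"
  shows "AE t in lborel. \<exists>d>0. \<forall>n. d \<le> cmod (cis t - z n)"
proof -
  let ?G = "\<Union>n. rho_disk (z n) \<sigma>"
  define C where "C = 2 / (1 - \<sigma>)"
  \<comment> \<open>The directions whose ray meets a disk beyond radius \<open>r\<close>.\<close>
  define U where "U = (\<lambda>r. {t. \<exists>\<rho>. r < \<rho> \<and> \<rho> < 1 \<and> of_real \<rho> * cis t \<in> ?G})"
  \<comment> \<open>A countable supply of radii tending to \<open>1\<close> keeps the exceptional set \<open>E\<close> countable.\<close>
  define R where "R = (\<lambda>j. 1 - 1 / (real j + 2))"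
  define E where "E = (\<Union>j. {t. t \<notin> U (R j) \<and> (\<exists>d>0. {t<..<t + d} \<subseteq> U (R j))}
                         \<union> {t. t \<notin> U (R j) \<and> (\<exists>d>0. {t - d<..<t} \<subseteq> U (R j))})"
  have z1: "cmod (z n) < 1" for n using z by (auto simp: blaschke_sequence_def)
  have zG: "z n \<in> ?G" for n
    using z \<sigma> by (auto simp: rho_disk_def rho_def blaschke_sequence_def intro!: exI[of _ n])
  have C: "C > 0" using \<sigma> by (simp add: C_def)
  have "AE t in lborel. finite {n. cmod (cis t - z n) \<le> (4 * C + 3) * (1 - cmod (z n))}"
    using z z1 C by (intro AE_cis_in_finitely_many_balls summable_mult)
      (auto simp: blaschke_sequence_def less_imp_le)
  moreover have "AE t in lborel. t \<notin> E"
  proof -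
    have "countable E"
      unfolding E_def using countable_left_endpoints countable_right_endpoints by blast
    thus ?thesis by (rule AE_not_in[OF countable_imp_null_set_lborel])
  qed
  ultimately show ?thesis
  proof eventually_elim
    case (elim t)
    obtain r0 where r0: "r0 < 1"
      "\<And>r. r0 \<le> r \<Longrightarrow> r < 1 \<Longrightarrow> ball (of_real r * cis t) ((1 - r) / 2) \<inter> ?G = {}"
      using cone_avoids_disks[OF z1 \<sigma>(2) elim(1)[unfolded C_def]] by auto
    have "R \<longlonglongrightarrow> 1" unfolding R_def by real_asymp
    hence "eventually (\<lambda>j. max r0 (cmod (z 0)) < R j) sequentially"
      using r0(1) z1[of 0] by (intro order_tendstoD) auto
    then obtain j where j: "max r0 (cmod (z 0)) < R j" by (auto simp: eventually_sequentially)
    define r where "r = R j"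
    have r: "0 < r" "r < 1" "r0 \<le> r" "cmod (z 0) \<le> r" using j by (auto simp: r_def R_def field_simps)
    have tU: "t \<notin> U r"
    proof
      assume "t \<in> U r"
      then obtain \<rho> where \<rho>: "r < \<rho>" "\<rho> < 1" "of_real \<rho> * cis t \<in> ?G" by (auto simp: U_def)
      moreover have "of_real \<rho> * cis t \<in> ball (of_real \<rho> * cis t) ((1 - \<rho>) / 2)" using \<rho> by simp
      moreover have "r0 \<le> \<rho>" using \<rho> r by linarith
      ultimately show False using r0(2)[of \<rho>] by blast
    qed
    have "0 < (1 - r) / 2" using r by simp
    hence "\<not> {t<..<t + (1 - r) / 2} \<subseteq> U r" "\<not> {t - (1 - r) / 2<..<t} \<subseteq> U r"
      using elim(2) tU unfolding E_def r_def by blast+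
    then obtain s1 s2 where "s1 \<in> {t<..<t + (1 - r) / 2}" and s1: "s1 \<notin> U r"
      and "s2 \<in> {t - (1 - r) / 2<..<t}" and s2: "s2 \<notin> U r" by blast
    hence t1: "t < s1" "s1 < t + (1 - r) / 2" and t2: "t - (1 - r) / 2 < s2" "s2 < t" by auto
    have "\<exists>d>0. ball (cis t) d \<inter> ?G = {}"
    proof (rule connected_avoiding_rays_stays_away[OF G _ r(1,2) zG[of 0] r(4) r0(2)[OF r(3,2)]
          t1 _ t2])
      show "?G \<subseteq> ball 0 1" by (auto simp: rho_disk_def)
      show "of_real \<rho> * cis s1 \<notin> ?G" if "r < \<rho>" "\<rho> < 1" for \<rho> using s1 that unfolding U_def by blast
      show "of_real \<rho> * cis s2 \<notin> ?G" if "r < \<rho>" "\<rho> < 1" for \<rho> using s2 that unfolding U_def by blast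
    qed
    then obtain d where d: "d > 0" "ball (cis t) d \<inter> ?G = {}" by blast
    have "d \<le> cmod (cis t - z n)" for n
    proof (rule ccontr)
      assume "\<not> ?thesis"
      hence "z n \<in> ball (cis t) d" by (simp add: dist_norm)
      thus False using d(2) zG[of n] by blast
    qed
    thus ?case using d(1) by blast
  qed
qed

section \<open>Radial limits\<close>

text \<open>On the closed radius at \<open>t\<close> the product converges uniformly, because
\<open>2 * cmod (1 - cnj a * r * cis t)\<close> is at least \<open>cmod (cis t - a)\<close>. So the limit function is continuous
up to the endpoint, where all partial products have modulus \<open>1\<close>.\<close>

lemma radial_limit_blaschke:
  assumes z: "blaschke_sequence z" and d: "0 < d" "\<And>n. d \<le> cmod (cis t - z n)"
  shows "\<exists>w. cmod w = 1 \<and>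
    ((\<lambda>r. \<Prod>n. blaschke_factor (z n) (of_real r * cis t)) \<longlongrightarrow> w) (at_left 1)"
proof -
  define f where "f = (\<lambda>r. \<Prod>n. blaschke_factor (z n) (of_real r * cis t))"
  have z1: "cmod (z n) < 1" for n using z by (auto simp: blaschke_sequence_def)
  define S where "S = (\<lambda>r. of_real r * cis t) ` {0..1}"
  have S: "S \<subseteq> cball 0 1" by (auto simp: S_def norm_mult)
  have cS: "compact S" unfolding S_def by (intro compact_continuous_image continuous_intros) auto
  have "uniform_limit S (\<lambda>N w. \<Prod>n<N. blaschke_factor (z n) w)
           (\<lambda>w. \<Prod>n. blaschke_factor (z n) w) sequentially"
  proof (rule uniform_limit_blaschke[OF z cS S, of "d / 2"])
    fix n w assume "w \<in> S"
    then obtain r where r: "w = of_real r * cis t" "0 \<le> r" "r \<le> 1" by (auto simp: S_def)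
    have "cmod (1 - cnj (z n) * cis t) = cmod (cis t - z n)"
    proof -
      have "1 - cnj (z n) * cis t = cis t * cnj (cis t - z n)"
        by (simp add: algebra_simps cis_cnj cis_mult)
      thus ?thesis by (simp add: norm_mult del: complex_cnj_diff)
    qed
    hence "d \<le> cmod (1 - cnj (z n) * cis t)" using d(2)[of n] by simp
    also have "1 - cnj (z n) * cis t = (1 - cnj (z n) * w) - of_real (1 - r) * (cnj (z n) * cis t)"
      unfolding r(1) by (simp add: algebra_simps)
    also have "cmod \<dots> \<le> cmod (1 - cnj (z n) * w) + cmod (of_real (1 - r) * (cnj (z n) * cis t))"
      by (rule norm_triangle_ineq4)
    also have "cmod (of_real (1 - r) * (cnj (z n) * cis t)) = (1 - r) * cmod (z n)"
      using r by (simp add: norm_mult del: of_real_diff)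
    also have "\<dots> \<le> 1 - r" using z1[of n] r by (intro mult_left_le) auto
    also have "1 - r \<le> cmod (1 - cnj (z n) * w)"
      using r by (intro norm_one_minus_cnj_mult_ge[OF z1]) (simp add: norm_mult)
    finally show "d / 2 \<le> cmod (1 - cnj (z n) * w)" by simp
  qed (use d in simp)
  hence lim: "uniform_limit {0..1} (\<lambda>N r. \<Prod>n<N. blaschke_factor (z n) (of_real r * cis t)) f sequentially"
    unfolding f_def S_def uniform_limit_iff by (simp add: ball_simps)
  have "continuous_on {0..1} f"
  proof (rule uniform_limit_theorem[OF _ lim])
    have "continuous_on {0..1} (\<lambda>r. blaschke_factor (z n) (of_real r * cis t))" for n
      using S unfolding S_def
      by (intro continuous_on_compose2[OF continuous_on_blaschke_factor[OF z1]] continuous_intros)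
    thus "\<forall>\<^sub>F N in sequentially. continuous_on {0..1}
            (\<lambda>r. \<Prod>n<N. blaschke_factor (z n) (of_real r * cis t))"
      by (intro always_eventually allI continuous_on_prod)
  qed simp
  hence "(f \<longlongrightarrow> f 1) (at 1 within {0..1})" by (auto simp: continuous_on_def)
  hence "(f \<longlongrightarrow> f 1) (at_left 1)" by (simp add: at_within_Icc_at_left)
  moreover have "cmod (f 1) = 1"
  proof -
    have "(\<lambda>N. cmod (\<Prod>n<N. blaschke_factor (z n) (of_real 1 * cis t))) \<longlonglongrightarrow> cmod (f 1)"
      using tendsto_uniform_limitI[OF lim, of 1] by (intro tendsto_norm) auto
    moreover have "cmod (\<Prod>n<N. blaschke_factor (z n) (of_real 1 * cis t)) = 1" for N
      using z1 by (simp add: norm_blaschke_factor rho_eq_1 flip: prod_norm)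
    ultimately show ?thesis by (simp add: LIMSEQ_const_iff)
  qed
  ultimately show ?thesis unfolding f_def by blast
qed

text \<open>The level is the radius \<open>\<sigma>\<close> itself.\<close>

lemma one_component_inner_if_connected_disks:
  assumes b: "blaschke_product b z" and \<sigma>: "0 < \<sigma>" "\<sigma> < 1"
    and G: "connected (\<Union>n. rho_disk (z n) \<sigma>)"
  shows "one_component_inner b"
proof -
  define B where "B = (\<lambda>w. \<Prod>n. blaschke_factor (z n) w)"
  obtain c where z: "blaschke_sequence z" and c: "cmod c = 1"
    and bB: "\<And>w. w \<in> unit_disk \<Longrightarrow> b w = c * B w"
    using b by (auto simp: blaschke_product_def B_def)
  have "(\<lambda>w. c * B w) holomorphic_on unit_disk"
    unfolding B_def by (intro holomorphic_intros holomorphic_blaschke_prodinf z)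
  hence hol: "b holomorphic_on unit_disk" by (rule holomorphic_transform) (simp add: bB)
  have "cmod (b w) \<le> 1" if "w \<in> unit_disk" for w
    using blaschke_prodinf_le_partial[OF z that, of 0] bB[OF that] c by (simp add: norm_mult B_def)
  hence bd: "bounded (b ` unit_disk)" by (intro boundedI[of _ 1]) blast
  have "AE t in lborel. \<exists>w. cmod w = 1 \<and> ((\<lambda>r. b (of_real r * cis t)) \<longlongrightarrow> w) (at_left 1)"
    using AE_cis_away_from_zeros[OF z \<sigma> G]
  proof eventually_elim
    case (elim t)
    then obtain w where w: "cmod w = 1" "((\<lambda>r. B (of_real r * cis t)) \<longlongrightarrow> w) (at_left 1)"
      using radial_limit_blaschke[OF z] unfolding B_def by blast
    have "eventually (\<lambda>r::real. r \<in> {0<..<1}) (at_left 1)" by (rule eventually_at_left_real) simp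
    hence "eventually (\<lambda>r. c * B (of_real r * cis t) = b (of_real r * cis t)) (at_left 1)"
      by eventually_elim (simp add: bB norm_mult)
    moreover have "((\<lambda>r. c * B (of_real r * cis t)) \<longlongrightarrow> c * w) (at_left 1)"
      using w(2) by (intro tendsto_intros)
    ultimately have "((\<lambda>r. b (of_real r * cis t)) \<longlongrightarrow> c * w) (at_left 1)"
      by (rule Lim_transform_eventually[rotated])
    thus ?case using c w(1) by (intro exI[of _ "c * w"]) (simp add: norm_mult)
  qed
  moreover have "level_set b \<sigma> = level_set B \<sigma>"
    using bB c by (auto simp: level_set_def norm_mult)
  ultimately show ?thesis
    using connected_level_set_if_connected_disks[OF z \<sigma> G] hol bd \<sigma>
    unfolding one_component_inner_def inner_function_def B_def by auto
qed

section \<open>Chains of overlapping disks\<close>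

text \<open>A pseudohyperbolic disk is the image of a Euclidean disk around \<open>0\<close> under a disk automorphism.\<close>

lemma connected_rho_disk:
  assumes a: "cmod a < 1"
  shows "connected (rho_disk a \<sigma>)"
proof -
  let ?M = "Moebius_function 0"
  have rM: "rho w a = cmod (?M a w)" for w
    by (subst rho_commute) (simp add: Moebius_function_simple rho_def norm_divide norm_minus_commute)
  have "rho_disk a \<sigma> = ?M (- a) ` (ball 0 (min 1 \<sigma>))"
  proof (intro equalityI subsetI)
    fix w assume w: "w \<in> rho_disk a \<sigma>"
    hence "?M a w \<in> ball 0 (min 1 \<sigma>)"
      using a Moebius_function_norm_lt_1[of a w 0] by (auto simp: rho_disk_def rM)
    moreover have "w = ?M (- a) (?M a w)"
      using Moebius_function_compose[of "- a" a w] a w by (auto simp: rho_disk_def)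
    ultimately show "w \<in> ?M (- a) ` (ball 0 (min 1 \<sigma>))" by blast
  next
    fix w assume "w \<in> ?M (- a) ` (ball 0 (min 1 \<sigma>))"
    then obtain v where v: "cmod v < 1" "cmod v < \<sigma>" "w = ?M (- a) v" by auto
    have "?M a w = v" using Moebius_function_compose[of a "- a" v] a v by auto
    thus "w \<in> rho_disk a \<sigma>"
      using v a Moebius_function_norm_lt_1[of "- a" v 0] by (auto simp: rho_disk_def rM)
  qed
  moreover have "continuous_on (ball 0 (min 1 \<sigma>)) (?M (- a))"
    using Moebius_function_holomorphic[of "- a" 0] a
    by (intro holomorphic_on_imp_continuous_on) (auto intro: holomorphic_on_subset)
  ultimately show ?thesis by (simp add: connected_continuous_image)
qed

lemma connected_disks_if_chain:
  assumes z: "\<And>n. cmod (z n) < 1" and chain: "\<And>n. rho (z n) (z (Suc n)) < \<sigma>"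
  shows "connected (\<Union>n. rho_disk (z n) \<sigma>)"
proof -
  have s0: "0 < \<sigma>" using chain[of 0] rho_nonneg[of "z 0" "z (Suc 0)"] by linarith
  have self: "z n \<in> rho_disk (z n) \<sigma>" for n using z s0 by (simp add: rho_disk_def rho_def)
  have "connected (\<Union>n\<le>N. rho_disk (z n) \<sigma>)" for N
  proof (induction N)
    case 0
    show ?case using connected_rho_disk[OF z] by simp
  next
    case (Suc N)
    have "z N \<in> rho_disk (z (Suc N)) \<sigma>" using z chain by (simp add: rho_disk_def)
    hence "z N \<in> (\<Union>n\<le>N. rho_disk (z n) \<sigma>) \<inter> rho_disk (z (Suc N)) \<sigma>" using self by blast
    hence "connected ((\<Union>n\<le>N. rho_disk (z n) \<sigma>) \<union> rho_disk (z (Suc N)) \<sigma>)"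
      using Suc.IH connected_rho_disk[OF z] by (intro connected_Un) auto
    thus ?case by (simp add: atMost_Suc Un_commute)
  qed
  hence "connected (\<Union>N. \<Union>n\<le>N. rho_disk (z n) \<sigma>)"
    using self[of 0] by (intro connected_Union) auto
  moreover have "(\<Union>N. \<Union>n\<le>N. rho_disk (z n) \<sigma>) = (\<Union>n. rho_disk (z n) \<sigma>)" by auto
  ultimately show ?thesis by simp
qed

section \<open>Zeros approaching the boundary geometrically\<close>

text \<open>Deleting a term yields again a sequence indexed by the natural numbers, so the results on Blaschke
products apply to the cofactor of one Blaschke factor.\<close>

definition omit :: "nat \<Rightarrow> (nat \<Rightarrow> 'a) \<Rightarrow> nat \<Rightarrow> 'a" where
  "omit n z m = z (if m < n then m else Suc m)"

lemma prod_lessThan_Suc_omit: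
  fixes g :: "'a \<Rightarrow> 'b::comm_monoid_mult"
  assumes "n \<le> N"
  shows "(\<Prod>m<Suc N. g (z m)) = g (z n) * (\<Prod>m<N. g (omit n z m))"
  using assms
proof (induction N rule: dec_induct)
  case base
  have "(\<Prod>m<n. g (omit n z m)) = (\<Prod>m<n. g (z m))" by (intro prod.cong) (auto simp: omit_def)
  thus ?case by (simp add: mult.commute)
next
  case (step N)
  have "(\<Prod>m<Suc (Suc N). g (z m)) = (\<Prod>m<Suc N. g (z m)) * g (z (Suc N))" by simp
  also have "\<dots> = g (z n) * (\<Prod>m<N. g (omit n z m)) * g (omit n z N)"
    using step by (simp add: omit_def)
  finally show ?case by (simp add: mult.assoc)
qed

lemma blaschke_sequence_omit:
  assumes "blaschke_sequence z"
  shows "blaschke_sequence (omit n z)"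
proof -
  have "summable (\<lambda>m. 1 - cmod (z (Suc m)))"
    using assms summable_Suc_iff[of "\<lambda>m. 1 - cmod (z m)"] by (simp add: blaschke_sequence_def)
  moreover have ev: "eventually (\<lambda>m. 1 - cmod (omit n z m) = 1 - cmod (z (Suc m))) sequentially"
    using eventually_ge_at_top[of n] by eventually_elim (simp add: omit_def)
  ultimately have "summable (\<lambda>m. 1 - cmod (omit n z m))" by (simp only: summable_cong[OF ev])
  thus ?thesis using assms by (auto simp: blaschke_sequence_def omit_def)
qed

lemma blaschke_prodinf_omit:
  assumes z: "blaschke_sequence z" and w: "w \<in> ball 0 1"
  shows "(\<Prod>m. blaschke_factor (z m) w)
           = blaschke_factor (z n) w * (\<Prod>m. blaschke_factor (omit n z m) w)"
proof (rule LIMSEQ_unique)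
  show "(\<lambda>N. \<Prod>m<Suc N. blaschke_factor (z m) w) \<longlonglongrightarrow> (\<Prod>m. blaschke_factor (z m) w)"
    using LIMSEQ_blaschke[OF z w] by (rule LIMSEQ_Suc)
  have "(\<lambda>N. blaschke_factor (z n) w * (\<Prod>m<N. blaschke_factor (omit n z m) w))
      \<longlonglongrightarrow> blaschke_factor (z n) w * (\<Prod>m. blaschke_factor (omit n z m) w)"
    by (intro tendsto_intros LIMSEQ_blaschke blaschke_sequence_omit z w)
  moreover have "eventually (\<lambda>N. blaschke_factor (z n) w * (\<Prod>m<N. blaschke_factor (omit n z m) w)
      = (\<Prod>m<Suc N. blaschke_factor (z m) w)) sequentially"
    using eventually_ge_at_top[of n]
    by eventually_elim (rule prod_lessThan_Suc_omit[of n _ "\<lambda>a. blaschke_factor a w", symmetric])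
  ultimately show "(\<lambda>N. \<Prod>m<Suc N. blaschke_factor (z m) w)
      \<longlonglongrightarrow> blaschke_factor (z n) w * (\<Prod>m. blaschke_factor (omit n z m) w)"
    by (rule Lim_transform_eventually)
qed

lemma blaschke_factor_deriv_at_zero:
  assumes a: "cmod a < 1"
  shows "\<exists>D. (blaschke_factor a has_field_derivative D) (at a) \<and> (1 - (cmod a)\<^sup>2) * cmod D = 1"
proof (cases "a = 0")
  case True
  have "(blaschke_factor a has_field_derivative 1) (at a)"
    using DERIV_ident by (simp add: True blaschke_factor_def[abs_def])
  thus ?thesis using True by (intro exI[of _ 1]) auto
next
  case False
  let ?q = "1 - cnj a * a" and ?c = "complex_of_real (cmod a) / a"
  have q: "?q \<noteq> 0" using one_minus_cnj_mult_nonzero[OF a, of a] a by simp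
  have "((\<lambda>w. ?c * ((a - w) / (1 - cnj a * w))) has_field_derivative ?c * (- 1 / ?q)) (at a)"
    using q False by (auto intro!: derivative_eq_intros)
  moreover have "blaschke_factor a = (\<lambda>w. ?c * ((a - w) / (1 - cnj a * w)))"
    using False by (auto simp: blaschke_factor_def)
  moreover have "(1 - (cmod a)\<^sup>2) * cmod (?c * (- 1 / ?q)) = 1"
  proof -
    have "?q = of_real (1 - (cmod a)\<^sup>2)" by (simp add: complex_norm_square[symmetric] mult.commute)
    moreover have p: "0 < 1 - (cmod a)\<^sup>2" using a by (simp add: power_less_one_iff abs_square_less_1)
    ultimately have "cmod ?q = 1 - (cmod a)\<^sup>2" by (metis abs_of_pos norm_of_real)
    moreover have "cmod ?c = 1" using False by (simp add: norm_divide)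
    ultimately show ?thesis using p False by (simp add: norm_mult norm_divide)
  qed
  ultimately show ?thesis by auto
qed

text \<open>Only the factor with zero \<open>z n\<close> contributes to the derivative at \<open>z n\<close>, and the derivative of that
factor there is the reciprocal of \<open>1 - (cmod (z n))\<^sup>2\<close> up to a unimodular constant.\<close>

lemma deriv_blaschke_at_zero:
  assumes b: "blaschke_product b z"
  shows "(1 - (cmod (z n))\<^sup>2) * cmod (deriv b (z n))
           = cmod (\<Prod>m. blaschke_factor (omit n z m) (z n))"
proof -
  define Q where "Q = (\<lambda>w. \<Prod>m. blaschke_factor (omit n z m) w)"
  obtain c where z: "blaschke_sequence z" and c: "cmod c = 1"
    and bB: "\<And>w. w \<in> unit_disk \<Longrightarrow> b w = c * (\<Prod>n. blaschke_factor (z n) w)"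
    using b by (auto simp: blaschke_product_def)
  have zn: "z n \<in> unit_disk" using z by (simp add: blaschke_sequence_def)
  have "Q holomorphic_on unit_disk"
    unfolding Q_def by (intro holomorphic_blaschke_prodinf blaschke_sequence_omit z)
  then obtain Q' where Q': "(Q has_field_derivative Q') (at (z n))"
    using zn holomorphic_on_open[OF open_ball] by blast
  obtain D where D: "(blaschke_factor (z n) has_field_derivative D) (at (z n))"
    "(1 - (cmod (z n))\<^sup>2) * cmod D = 1"
    using blaschke_factor_deriv_at_zero zn by auto
  have z0: "blaschke_factor (z n) (z n) = 0" by (simp add: blaschke_factor_def)
  have "((\<lambda>w. c * (blaschke_factor (z n) w * Q w)) has_field_derivative c * (D * Q (z n))) (at (z n))"
    using z0 by (auto intro!: derivative_eq_intros D Q')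
  hence "(b has_field_derivative c * (D * Q (z n))) (at (z n))"
  proof (rule has_field_derivative_transform_within_open[OF _ open_ball zn])
    fix w assume w: "w \<in> unit_disk"
    show "c * (blaschke_factor (z n) w * Q w) = b w"
      by (simp only: bB[OF w] blaschke_prodinf_omit[OF z w, of n] Q_def)
  qed
  hence "deriv b (z n) = c * (D * Q (z n))" by (rule DERIV_imp_deriv)
  hence "(1 - (cmod (z n))\<^sup>2) * cmod (deriv b (z n)) = ((1 - (cmod (z n))\<^sup>2) * cmod D) * cmod (Q (z n))"
    using c by (simp add: norm_mult)
  thus ?thesis by (simp add: D(2) Q_def)
qed

text \<open>By \<open>deriv_blaschke_at_zero\<close> the quantity in the definition of an interpolating Blaschke product is
the limit of these partial products as \<open>N\<close> grows.\<close>

lemma interpolating_if_separated: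
  assumes b: "blaschke_product b z" and \<delta>: "0 < \<delta>"
    and sep: "\<And>n N. n \<le> N \<Longrightarrow> \<delta> \<le> (\<Prod>m<N. rho (z n) (omit n z m))"
  shows "interpolating_blaschke_product b z"
proof -
  have z: "blaschke_sequence z" using b by (simp add: blaschke_product_def)
  have "\<delta> \<le> (1 - (cmod (z n))\<^sup>2) * cmod (deriv b (z n))" for n
    unfolding deriv_blaschke_at_zero[OF b]
  proof (rule LIMSEQ_le_const)
    show "(\<lambda>N. cmod (\<Prod>m<N. blaschke_factor (omit n z m) (z n)))
        \<longlonglongrightarrow> cmod (\<Prod>m. blaschke_factor (omit n z m) (z n))"
      using z by (intro tendsto_norm LIMSEQ_blaschke blaschke_sequence_omit)
        (auto simp: blaschke_sequence_def)
    show "\<exists>M. \<forall>N\<ge>M. \<delta> \<le> cmod (\<Prod>m<N. blaschke_factor (omit n z m) (z n))"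
      using sep by (auto simp: norm_blaschke_factor simp flip: prod_norm)
  qed
  hence "\<delta> \<le> (INF n. (1 - (cmod (z n))\<^sup>2) * cmod (deriv b (z n)))"
    by (intro cINF_greatest) auto
  thus ?thesis using b \<delta> by (simp add: interpolating_blaschke_product_def)
qed

text \<open>With \<open>p = 1 - z n\<close> and \<open>q = 2 ^ (- j)\<close> the distance equals \<open>(1 - q) / (1 + q - p * q)\<close>; dropping
\<open>p * q\<close> gives a bound that depends on the index difference alone.\<close>

lemma rho_dyadic_ge:
  assumes zn: "\<And>n. z n = 1 - 1 / 2 ^ (n + k)"
  shows "(1 - 1 / 2 ^ j) / (1 + 1 / 2 ^ j) \<le> rho (z n) (z (n + j))"
proof -
  define p q :: real where "p = 1 / 2 ^ (n + k)" and "q = 1 / 2 ^ j"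
  have p: "0 < p" "p \<le> 1" and q: "0 < q" "q \<le> 1" by (auto simp: p_def q_def)
  have pq: "p * q \<le> 1" using p q by (simp add: mult_le_one)
  have z1: "z n = of_real (1 - p)" and z2: "z (n + j) = of_real (1 - p * q)"
    unfolding zn by (simp_all add: p_def q_def power_add mult_ac)
  have "rho (z n) (z (n + j)) = \<bar>((1 - p) - (1 - p * q)) / (1 - (1 - p) * (1 - p * q))\<bar>"
  proof -
    have "(of_real (1 - p) - of_real (1 - p * q)) / (1 - of_real (1 - p) * of_real (1 - p * q))
        = complex_of_real (((1 - p) - (1 - p * q)) / (1 - (1 - p) * (1 - p * q)))" by simp
    thus ?thesis unfolding rho_def z1 z2 complex_cnj_complex_of_real by (metis norm_of_real)
  qed
  also have "((1 - p) - (1 - p * q)) / (1 - (1 - p) * (1 - p * q)) = - ((1 - q) / (1 + q - p * q))"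
  proof -
    have e1: "(1 - p) - (1 - p * q) = p * (- (1 - q))" by (simp add: algebra_simps)
    have e2: "1 - (1 - p) * (1 - p * q) = p * (1 + q - p * q)" by (simp add: algebra_simps)
    show ?thesis
      unfolding e1 e2 minus_divide_left using p by (subst mult_divide_mult_cancel_left) auto
  qed
  also have "\<bar>- ((1 - q) / (1 + q - p * q))\<bar> = (1 - q) / (1 + q - p * q)"
    using p q pq by simp
  finally have "rho (z n) (z (n + j)) = (1 - q) / (1 + q - p * q)" .
  moreover have "(1 - q) / (1 + q) \<le> (1 - q) / (1 + q - p * q)"
    using p q pq by (intro divide_left_mono) auto
  ultimately show ?thesis by (simp add: q_def)
qed

text \<open>The bare bound \<open>1 / 10\<close> is not inductive. The strengthened bound \<open>(1 + 4 / 2 ^ M) / 10\<close> is, from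
\<open>M = 2\<close> on, where it holds with equality.\<close>

lemma prod_dyadic_ge:
  "1 / 10 \<le> (\<Prod>j<M. (1 - 1 / 2 ^ Suc j) / (1 + 1 / 2 ^ Suc j :: real))"
proof -
  let ?f = "\<lambda>j. (1 - 1 / 2 ^ Suc j) / (1 + 1 / 2 ^ Suc j :: real)"
  have step: "1 / 10 * (1 + 4 / 2 ^ M) \<le> (\<Prod>j<M. ?f j)" if "2 \<le> M" for M
    using that
  proof (induction M rule: dec_induct)
    case base
    show ?case by (simp add: numeral_2_eq_2)
  next
    case (step M)
    define y :: real where "y = 1 / 2 ^ M"
    have "(2::real) ^ 2 \<le> 2 ^ M" using step(1) by (intro power_increasing) auto
    hence y: "0 < y" "y \<le> 1 / 4" by (auto simp: y_def field_simps)
    have "(1 + 2 * y) * (1 + y / 2) \<le> (1 + 4 * y) * (1 - y / 2)"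
    proof -
      have "y * (3 * y) \<le> y * 1" using y by (intro mult_left_mono) auto
      thus ?thesis by (simp add: algebra_simps)
    qed
    hence "1 + 2 * y \<le> (1 + 4 * y) * ((1 - y / 2) / (1 + y / 2))"
      unfolding times_divide_eq_right using y by (subst pos_le_divide_eq) auto
    hence "1 / 10 * (1 + 2 * y) \<le> 1 / 10 * (1 + 4 * y) * ((1 - y / 2) / (1 + y / 2))"
      unfolding mult.assoc by (rule mult_left_mono) simp
    also have "\<dots> \<le> (\<Prod>j<M. ?f j) * ((1 - y / 2) / (1 + y / 2))"
      using step.IH y by (intro mult_right_mono) (auto simp: y_def)
    also have "\<dots> = (\<Prod>j<Suc M. ?f j)" by (simp add: y_def mult.commute)
    finally show ?case by (simp add: y_def)
  qed
  consider "M = 0" | "M = 1" | "2 \<le> M" by linarith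
  thus ?thesis
  proof cases
    case 3
    have "1 / 10 \<le> 1 / 10 * (1 + 4 / 2 ^ M :: real)" by simp
    thus ?thesis using step[OF 3] by linarith
  qed auto
qed

text \<open>The indices below \<open>n\<close> and those above \<open>n\<close> each contribute a partial product of
\<open>(1 - 2 ^ (- j)) / (1 + 2 ^ (- j))\<close> over \<open>j \<ge> 1\<close>.\<close>

lemma dyadic_separated:
  assumes zn: "\<And>n. z n = 1 - 1 / 2 ^ (n + k)" and nN: "n \<le> N"
  shows "1 / 100 \<le> (\<Prod>m<N. rho (z n) (omit n z m))"
proof -
  let ?f = "\<lambda>j. (1 - 1 / 2 ^ Suc j) / (1 + 1 / 2 ^ Suc j :: real)"
  have f0: "0 \<le> ?f j" for j
    using one_le_power[of "2::real" "Suc j"] by (intro divide_nonneg_pos add_pos_pos) auto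
  have "(\<Prod>j<n. ?f j) = (\<Prod>m<n. ?f (n - Suc m))" by (rule prod.nat_diff_reindex[symmetric])
  also have "\<dots> \<le> (\<Prod>m<n. rho (z n) (omit n z m))"
  proof (intro prod_mono conjI f0)
    fix m assume m: "m \<in> {..<n}"
    have "?f (n - Suc m) \<le> rho (z m) (z (m + Suc (n - Suc m)))"
      by (rule rho_dyadic_ge[OF zn])
    also have "m + Suc (n - Suc m) = n" using m by simp
    finally show "?f (n - Suc m) \<le> rho (z n) (omit n z m)" using m by (simp add: omit_def rho_commute)
  qed
  finally have A: "1 / 10 \<le> (\<Prod>m<n. rho (z n) (omit n z m))" using prod_dyadic_ge[of n] by linarith
  have "(\<Prod>j<N - n. ?f j) \<le> (\<Prod>j<N - n. rho (z n) (omit n z (j + n)))"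
  proof (intro prod_mono conjI f0)
    fix j
    have "?f j \<le> rho (z n) (z (n + Suc j))" by (rule rho_dyadic_ge[OF zn])
    thus "?f j \<le> rho (z n) (omit n z (j + n))" by (simp add: omit_def add.commute)
  qed
  also have "\<dots> = (\<Prod>m\<in>{n..<N}. rho (z n) (omit n z m))"
    using nN prod.shift_bounds_nat_ivl[of "\<lambda>m. rho (z n) (omit n z m)" 0 n "N - n"] by (simp add: atLeast0LessThan)
  finally have B: "1 / 10 \<le> (\<Prod>m\<in>{n..<N}. rho (z n) (omit n z m))"
    using prod_dyadic_ge[of "N - n"] by linarith
  have "1 / 100 = (1 / 10) * (1 / 10 :: real)" by simp
  also have "\<dots> \<le> (\<Prod>m<n. rho (z n) (omit n z m)) * (\<Prod>m\<in>{n..<N}. rho (z n) (omit n z m))"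
    using A B by (intro mult_mono) auto
  also have "\<dots> = (\<Prod>m<N. rho (z n) (omit n z m))"
    using nN prod.atLeastLessThan_concat[of 0 n N "\<lambda>m. rho (z n) (omit n z m)"] by (simp add: atLeast0LessThan)
  finally show ?thesis .
qed

lemma blaschke_sequence_dyadic:
  assumes zn: "\<And>n. z n = 1 - 1 / 2 ^ (n + k)"
  shows "blaschke_sequence z"
proof -
  have nz: "cmod (z n) = 1 - 1 / 2 ^ (n + k)" for n
  proof -
    have "z n = of_real (1 - 1 / 2 ^ (n + k))" by (simp add: zn)
    moreover have "0 \<le> 1 - 1 / (2::real) ^ (n + k)" by simp
    ultimately show ?thesis by (metis abs_of_nonneg norm_of_real)
  qed
  have "summable (\<lambda>n. (1 / 2 ^ k) * (1 / 2 :: real) ^ n)"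
    by (intro summable_mult summable_geometric) simp
  thus ?thesis by (simp add: blaschke_sequence_def nz power_add power_divide mult.commute)
qed

lemma rho_dyadic_consecutive:
  assumes zn: "\<And>n. z n = 1 - 1 / 2 ^ (n + k)"
  shows "rho (z n) (z (Suc n)) < 3 / 4"
proof -
  define p :: real where "p = 1 / 2 ^ (n + k)"
  have p: "0 < p" "p \<le> 1" by (auto simp: p_def)
  have z1: "z n = of_real (1 - p)" and z2: "z (Suc n) = of_real (1 - p / 2)"
    unfolding zn by (simp_all add: p_def)
  have "rho (z n) (z (Suc n)) = \<bar>((1 - p) - (1 - p / 2)) / (1 - (1 - p) * (1 - p / 2))\<bar>"
  proof -
    have "(of_real (1 - p) - of_real (1 - p / 2)) / (1 - of_real (1 - p) * of_real (1 - p / 2))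
        = complex_of_real (((1 - p) - (1 - p / 2)) / (1 - (1 - p) * (1 - p / 2)))" by simp
    thus ?thesis unfolding rho_def z1 z2 complex_cnj_complex_of_real by (metis norm_of_real)
  qed
  also have "((1 - p) - (1 - p / 2)) / (1 - (1 - p) * (1 - p / 2)) = - (1 / (3 - p))"
  proof -
    have e1: "(1 - p) - (1 - p / 2) = (p / 2) * (- 1)" by simp
    have e2: "1 - (1 - p) * (1 - p / 2) = (p / 2) * (3 - p)" by (simp add: field_simps)
    show ?thesis
      unfolding e1 e2 minus_divide_left using p by (subst mult_divide_mult_cancel_left) auto
  qed
  also have "\<bar>- (1 / (3 - p))\<bar> < 3 / 4" using p by (simp add: field_simps)
  finally show ?thesis .
qed

section \<open>One-component inner functions\<close>

theorem theorem2p3: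
  "(\<forall>b z \<sigma>. interpolating_blaschke_product b z \<and> 0 < \<sigma> \<and> \<sigma> < 1 \<and>
        connected (\<Union>n. rho_disk (z n) \<sigma>)
      \<longrightarrow> one_component_inner b) \<and>
   (\<forall>b z \<sigma>. interpolating_blaschke_product b z \<and> \<sigma> < 1 \<and>
        (\<forall>n. rho (z n) (z (Suc n)) < \<sigma>)
      \<longrightarrow> one_component_inner b) \<and>
   (\<forall>k\<in>{0, 1 :: nat}. \<forall>z :: nat \<Rightarrow> complex. (\<forall>n. z n = 1 - 1 / 2 ^ (n + k)) \<longrightarrow>
        blaschke_sequence z \<and>
        (\<exists>\<sigma><1. \<forall>n. rho (z n) (z (Suc n)) < \<sigma>) \<and>
        (\<forall>b. blaschke_product b z \<longrightarrow>
             interpolating_blaschke_product b z \<and> one_component_inner b))"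
proof -
  have chain: "one_component_inner b"
    if b: "blaschke_product b z" and \<sigma>: "\<sigma> < 1" and ch: "\<And>n. rho (z n) (z (Suc n)) < \<sigma>" for b z \<sigma>
  proof -
    have "cmod (z n) < 1" for n using b by (auto simp: blaschke_product_def blaschke_sequence_def)
    hence "connected (\<Union>n. rho_disk (z n) \<sigma>)" using ch by (rule connected_disks_if_chain)
    moreover have "0 < \<sigma>" using ch[of 0] rho_nonneg[of "z 0" "z (Suc 0)"] by linarith
    ultimately show ?thesis using one_component_inner_if_connected_disks[OF b _ \<sigma>] by blast
  qed
  show ?thesis
  proof (intro conjI allI impI ballI)
    fix b z and \<sigma> :: real
    assume "interpolating_blaschke_product b z \<and> 0 < \<sigma> \<and> \<sigma> < 1 \<and> connected (\<Union>n. rho_disk (z n) \<sigma>)"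
    thus "one_component_inner b"
      using one_component_inner_if_connected_disks by (auto simp: interpolating_blaschke_product_def)
  next
    fix b z and \<sigma> :: real
    assume "interpolating_blaschke_product b z \<and> \<sigma> < 1 \<and> (\<forall>n. rho (z n) (z (Suc n)) < \<sigma>)"
    thus "one_component_inner b" using chain by (auto simp: interpolating_blaschke_product_def)
  next
    fix k :: nat and z :: "nat \<Rightarrow> complex"
    assume "\<forall>n. z n = 1 - 1 / 2 ^ (n + k)"
    hence zn: "\<And>n. z n = 1 - 1 / 2 ^ (n + k)" by blast
    show "blaschke_sequence z" by (rule blaschke_sequence_dyadic[OF zn])
    show "\<exists>\<sigma><1. \<forall>n. rho (z n) (z (Suc n)) < \<sigma>"
      using rho_dyadic_consecutive[OF zn] by (intro exI[of _ "3 / 4"]) simp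
    fix b assume b: "blaschke_product b z"
    show "interpolating_blaschke_product b z"
      by (rule interpolating_if_separated[OF b _ dyadic_separated[OF zn]]) auto
    show "one_component_inner b"
      by (rule chain[OF b _ rho_dyadic_consecutive[OF zn]]) simp
  qed
qed

end
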